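(* Let $A$ be a group. If $(f,\lambda),(f',\lambda')\colon(S,\mathscr{S},l)\to(T,\mathscr{T},m)$ are morphisms that are homotopic in $\mathsf{Simp}^A$, then $\Pi(f,\lambda)$ and $\Pi(f',\lambda')$ are homotopic in $\mathsf{Poset}^A$. In particular, $\Pi$ induces a functor $\overline{\Pi}\colon\mathscr{H}(\mathsf{Simp}^A)\to\mathscr{H}(\mathsf{Poset}^A)$ which restricts to a functor $\overline{\Pi}\colon\mathscr{H}(\mathsf{simp}^A)\to\mathscr{H}(\mathsf{poset}^A)$ such that $\overline{\Pi}\circ Q'=Q\circ\Pi$ as functors $\mathsf{Simp}^A\to\mathscr{H}(\mathsf{Poset}^A)$ and, respectively, as functors $\mathsf{simp}^A\to\mathscr{H}(\mathsf{poset}^A)$, where $Q$ and $Q'$ denote the canonical functors from the respective categories to their homotopy categories (identity on objects, sending a morphism to its homotopy class).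
   Context: $A$-monomial posets. An $A$-monomial poset is a pair $(X,l)$ where $X$ is a poset and $l$ assigns to each pair $x\le x'$ in $X$ an element $l(x,x')\in A$ with $l(x',x'')\,l(x,x')=l(x,x'')$ for $x\le x'\le x''$ and $l(x,x)=1_A$. A morphism $(X,l)\to(Y,m)$ is a pair $(f,\lambda)$ with $f\colon X\to Y$ order-preserving and $\lambda\colon X\to A$ a function with $m(f(x),f(x'))\,\lambda(x)=\lambda(x')\,l(x,x')$ for all $x\le x'$. Composition: $(e,\mu)\circ(f,\lambda)=(e\circ f,\ x\mapsto\mu(f(x))\lambda(x))$. This is the category $\mathsf{Poset}^A$; $\mathsf{poset}^A$ is the full subcategory with $X$ finite. Homotopy in $\mathsf{Poset}^A$. For $(f,\lambda),(f',\lambda')\colon(X,l)\to(Y,m)$, write $(f,\lambda)\le(f',\lambda')$ if for all $x\in X$: $f(x)\le f'(x)$ and $m(f(x),f'(x))\,\lambda(x)=\lambda'(x)$. This is a partial order on the set of morphisms. Two morphisms are comparable if one is $\le$ the other, and homotopic ($\sim$) if they are related by the transitive closure of comparability (a finite chain of comparable morphisms). $A$-monomial simplicial complexes. A simplicial complex is a pair $(S,\mathscr{S})$, $S$ a set and $\mathscr{S}$ a set of nonempty finite subsets of $S$ (simplices) containing all singletons and closed under taking nonempty subsets. A simplicial map $(S,\mathscr S)\to(T,\mathscr T)$ is a map $f\colon S\to T$ with $f(\sigma)\in\mathscr{T}$ for all $\sigma\in\mathscr{S}$. An $A$-monomial simplicial complex is a triple $(S,\mathscr{S},l)$ with $(S,\mathscr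 S)$ a simplicial complex and $l$ assigning to each pair $\sigma\subseteq\sigma'$ in $\mathscr{S}$ an element $l(\sigma,\sigma')\in A$ with $l(\sigma',\sigma'')\,l(\sigma,\sigma')=l(\sigma,\sigma'')$ for $\sigma\subseteq\sigma'\subseteq\sigma''$ and $l(\sigma,\sigma)=1_A$. A morphism $(S,\mathscr{S},l)\to(T,\mathscr{T},m)$ is a pair $(f,\lambda)$ with $f$ a simplicial map and $\lambda\colon\mathscr{S}\to A$ a function with $m(f(\sigma),f(\sigma'))\,\lambda(\sigma)=\lambda(\sigma')\,l(\sigma,\sigma')$ for $\sigma\subseteq\sigma'$. Composition: $(e,\mu)\circ(f,\lambda)=(e\circ f,\ \sigma\mapsto\mu(f(\sigma))\lambda(\sigma))$. This is the category $\mathsf{Simp}^A$; $\mathsf{simp}^A$ is the full subcategory with $S$ finite. Homotopy in $\mathsf{Simp}^A$. Morphisms $(f,\lambda),(f',\lambda')\colon(S,\mathscr S,l)\to(T,\mathscr T,m)$ are contiguous if for every $\sigma\in\mathscr{S}$: $f(\sigma)\cup f'(\sigma)\in\mathscr{T}$ and $m(f(\sigma),f(\sigma)\cup f'(\sigma))\,\lambda(\sigma)=m(f'(\sigma),f(\sigma)\cup f'(\sigma))\,\lambda'(\sigma)$. Homotopic ($\sim$) means related by the transitive closure of contiguity. Homotopy categories. Homotopy is compatible with composition in both categories, and $\mathscr{H}(\mathsf{C})$ has the same objects as $\mathsf{C}$ and homotopy classes of morphisms as morphisms, for $\mathsf{C}=\mathsf{Poset}^A$ or $\mathsf{Simp}^A$;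 $\mathscr{H}(\mathsf{poset}^A)$ and $\mathscr{H}(\mathsf{simp}^A)$ are the full subcategories of these on the finite objects. The functor $\Pi\colon\mathsf{Simp}^A\to\mathsf{Poset}^A$. On objects, $\Pi(S,\mathscr{S},l)=(\mathscr{S},l)$, with $\mathscr{S}$ partially ordered by inclusion. On morphisms, $\Pi(f,\lambda)=(f,\lambda)$, where on the right $f$ denotes the induced map $\mathscr{S}\to\mathscr{T}$, $\sigma\mapsto f(\sigma)$. It restricts to $\Pi\colon\mathsf{simp}^A\to\mathsf{poset}^A$. *)

theory Defs
  imports "HOL-Algebra.Group"
begin

text \<open>
  A category is given by its objects, hom-sets, composition and identities. Hom-sets of different
  pairs of objects are allowed to overlap, so composition and the action of a functor on morphisms
  take the objects involved as arguments: \<open>Comp C X Y Z g f\<close> is \<open>g\<close> after \<open>f\<close>, for \<open>f\<close> from \<open>X\<close> to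
  \<open>Y\<close> and \<open>g\<close> from \<open>Y\<close> to \<open>Z\<close>. Values outside the objects and hom-sets carry no meaning; two
  functors are therefore compared on objects and morphisms of the source only.
\<close>

record ('o, 'm) cat =
  Obj :: "'o set"
  Hom :: "'o \<Rightarrow> 'o \<Rightarrow> 'm set"
  Comp :: "'o \<Rightarrow> 'o \<Rightarrow> 'o \<Rightarrow> 'm \<Rightarrow> 'm \<Rightarrow> 'm"
  Ident :: "'o \<Rightarrow> 'm"

definition is_category :: "('o, 'm) cat \<Rightarrow> bool" where
  "is_category C \<longleftrightarrow>
     (\<forall>X\<in>Obj C. Ident C X \<in> Hom C X X) \<and>
     (\<forall>X\<in>Obj C. \<forall>Y\<in>Obj C. \<forall>Z\<in>Obj C. \<forall>f\<in>Hom C X Y. \<forall>g\<in>Hom C Y Z.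
        Comp C X Y Z g f \<in> Hom C X Z) \<and>
     (\<forall>X\<in>Obj C. \<forall>Y\<in>Obj C. \<forall>f\<in>Hom C X Y.
        Comp C X X Y f (Ident C X) = f \<and> Comp C X Y Y (Ident C Y) f = f) \<and>
     (\<forall>W\<in>Obj C. \<forall>X\<in>Obj C. \<forall>Y\<in>Obj C. \<forall>Z\<in>Obj C.
      \<forall>f\<in>Hom C W X. \<forall>g\<in>Hom C X Y. \<forall>h\<in>Hom C Y Z.
        Comp C W Y Z h (Comp C W X Y g f) = Comp C W X Z (Comp C X Y Z h g) f)"

record ('o, 'm, 'p, 'n) cat_functor =
  fobj :: "'o \<Rightarrow> 'p"
  fmor :: "'o \<Rightarrow> 'o \<Rightarrow> 'm \<Rightarrow> 'n"

definition is_functor :: "('o, 'm) cat \<Rightarrow> ('p, 'n) cat \<Rightarrow> ('o, 'm, 'p, 'n) cat_functor \<Rightarrow> bool" where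
  "is_functor C D F \<longleftrightarrow>
     is_category C \<and> is_category D \<and>
     (\<forall>X\<in>Obj C. fobj F X \<in> Obj D) \<and>
     (\<forall>X\<in>Obj C. \<forall>Y\<in>Obj C. \<forall>f\<in>Hom C X Y. fmor F X Y f \<in> Hom D (fobj F X) (fobj F Y)) \<and>
     (\<forall>X\<in>Obj C. fmor F X X (Ident C X) = Ident D (fobj F X)) \<and>
     (\<forall>X\<in>Obj C. \<forall>Y\<in>Obj C. \<forall>Z\<in>Obj C. \<forall>f\<in>Hom C X Y. \<forall>g\<in>Hom C Y Z.
        fmor F X Z (Comp C X Y Z g f) =
          Comp D (fobj F X) (fobj F Y) (fobj F Z) (fmor F Y Z g) (fmor F X Y f))"

definition functor_comp ::
  "('p, 'n, 'q, 'k) cat_functor \<Rightarrow> ('o, 'm, 'p, 'n) cat_functor \<Rightarrow> ('o, 'm, 'q, 'k) cat_functor" where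
  "functor_comp G F =
     \<lparr> fobj = (\<lambda>X. fobj G (fobj F X)),
       fmor = (\<lambda>X Y f. fmor G (fobj F X) (fobj F Y) (fmor F X Y f)) \<rparr>"

definition equal_functors ::
  "('o, 'm) cat \<Rightarrow> ('p, 'n) cat \<Rightarrow> ('o, 'm, 'p, 'n) cat_functor \<Rightarrow> ('o, 'm, 'p, 'n) cat_functor \<Rightarrow> bool" where
  "equal_functors C D F G \<longleftrightarrow>
     is_functor C D F \<and> is_functor C D G \<and>
     (\<forall>X\<in>Obj C. fobj F X = fobj G X) \<and>
     (\<forall>X\<in>Obj C. \<forall>Y\<in>Obj C. \<forall>f\<in>Hom C X Y. fmor F X Y f = fmor G X Y f)"

definition full_subcat :: "('o, 'm) cat \<Rightarrow> ('o \<Rightarrow> bool) \<Rightarrow> ('o, 'm) cat" where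
  "full_subcat C P = C\<lparr>Obj := {X \<in> Obj C. P X}\<rparr>"

text \<open>
  Morphisms of the quotient by a family \<open>R X Y\<close> of equivalence relations on the hom-sets are
  equivalence classes. If \<open>R\<close> is compatible with composition, the union defining the composite of
  two classes is the single class of the composites of representatives.
\<close>

definition quotient_cat :: "('o, 'm) cat \<Rightarrow> ('o \<Rightarrow> 'o \<Rightarrow> ('m \<times> 'm) set) \<Rightarrow> ('o, 'm set) cat" where
  "quotient_cat C R =
     \<lparr> Obj = Obj C,
       Hom = (\<lambda>X Y. Hom C X Y // R X Y),
       Comp = (\<lambda>X Y Z G F. \<Union>g\<in>G. \<Union>f\<in>F. R X Z `` {Comp C X Y Z g f}),
       Ident = (\<lambda>X. R X X `` {Ident C X}) \<rparr>"

definition quotient_functor :: "('o \<Rightarrow> 'o \<Rightarrow> ('m \<times> 'm) set) \<Rightarrow> ('o, 'm, 'o, 'm set) cat_functor" where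
  "quotient_functor R = \<lparr> fobj = (\<lambda>X. X), fmor = (\<lambda>X Y f. R X Y `` {f}) \<rparr>"

text \<open>
  The labelling \<open>l(x,x')\<close> is a function on the pairs in the order relation. Labellings and the
  components of morphisms are taken extensional (\<open>undefined\<close> off their domain), so that HOL
  equality of objects and of morphisms is the intended one.
\<close>

record ('x, 'a) mposet =
  Elts :: "'x set"
  Leq :: "('x \<times> 'x) set"
  plabel :: "'x \<times> 'x \<Rightarrow> 'a"

type_synonym ('x, 'y, 'a) poset_mor = "('x \<Rightarrow> 'y) \<times> ('x \<Rightarrow> 'a)"

definition monomial_poset :: "('a, 'b) monoid_scheme \<Rightarrow> ('x, 'a) mposet \<Rightarrow> bool" where
  "monomial_poset A X \<longleftrightarrow>
     partial_order_on (Elts X) (Leq X) \<and>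
     plabel X \<in> Leq X \<rightarrow>\<^sub>E carrier A \<and>
     (\<forall>x x' x''. (x, x') \<in> Leq X \<and> (x', x'') \<in> Leq X \<longrightarrow>
        plabel X (x', x'') \<otimes>\<^bsub>A\<^esub> plabel X (x, x') = plabel X (x, x'')) \<and>
     (\<forall>x\<in>Elts X. plabel X (x, x) = \<one>\<^bsub>A\<^esub>)"

definition poset_hom ::
  "('a, 'b) monoid_scheme \<Rightarrow> ('x, 'a) mposet \<Rightarrow> ('y, 'a) mposet \<Rightarrow> ('x, 'y, 'a) poset_mor set" where
  "poset_hom A X Y = {(f, u).
     f \<in> Elts X \<rightarrow>\<^sub>E Elts Y \<and>
     u \<in> Elts X \<rightarrow>\<^sub>E carrier A \<and>
     (\<forall>(x, x')\<in>Leq X. (f x, f x') \<in> Leq Y \<and>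
        plabel Y (f x, f x') \<otimes>\<^bsub>A\<^esub> u x = u x' \<otimes>\<^bsub>A\<^esub> plabel X (x, x'))}"

definition poset_comp ::
  "('a, 'b) monoid_scheme \<Rightarrow> ('x, 'a) mposet \<Rightarrow>
   ('y, 'z, 'a) poset_mor \<Rightarrow> ('x, 'y, 'a) poset_mor \<Rightarrow> ('x, 'z, 'a) poset_mor" where
  "poset_comp A X = (\<lambda>(e, v) (f, u).
     (\<lambda>x\<in>Elts X. e (f x), \<lambda>x\<in>Elts X. v (f x) \<otimes>\<^bsub>A\<^esub> u x))"

definition Poset_cat :: "('a, 'b) monoid_scheme \<Rightarrow> (('x, 'a) mposet, ('x, 'x, 'a) poset_mor) cat" where
  "Poset_cat A =
     \<lparr> Obj = {X. monomial_poset A X},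
       Hom = poset_hom A,
       Comp = (\<lambda>X Y Z. poset_comp A X),
       Ident = (\<lambda>X. (\<lambda>x\<in>Elts X. x, \<lambda>x\<in>Elts X. \<one>\<^bsub>A\<^esub>)) \<rparr>"

definition poset_hom_le ::
  "('a, 'b) monoid_scheme \<Rightarrow> ('x, 'a) mposet \<Rightarrow> ('y, 'a) mposet \<Rightarrow>
   ('x, 'y, 'a) poset_mor \<Rightarrow> ('x, 'y, 'a) poset_mor \<Rightarrow> bool" where
  "poset_hom_le A X Y = (\<lambda>(f, u) (f', u').
     \<forall>x\<in>Elts X. (f x, f' x) \<in> Leq Y \<and> plabel Y (f x, f' x) \<otimes>\<^bsub>A\<^esub> u x = u' x)"

text \<open>
  Both homotopy relations are transitive closures of reflexive relations on the hom-set, so they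
  are reflexive there and do not leave it.
\<close>

definition poset_homotopy ::
  "('a, 'b) monoid_scheme \<Rightarrow> ('x, 'a) mposet \<Rightarrow> ('y, 'a) mposet \<Rightarrow>
   (('x, 'y, 'a) poset_mor \<times> ('x, 'y, 'a) poset_mor) set" where
  "poset_homotopy A X Y =
     {(p, q). p \<in> poset_hom A X Y \<and> q \<in> poset_hom A X Y \<and>
        (poset_hom_le A X Y p q \<or> poset_hom_le A X Y q p)}\<^sup>+"

definition simplicial_complex_on :: "'s set \<Rightarrow> 's set set \<Rightarrow> bool" where
  "simplicial_complex_on S K \<longleftrightarrow>
     (\<forall>\<sigma>\<in>K. \<sigma> \<noteq> {} \<and> finite \<sigma> \<and> \<sigma> \<subseteq> S) \<and>
     (\<forall>v\<in>S. {v} \<in> K) \<and>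
     (\<forall>\<sigma>\<in>K. \<forall>\<tau>. \<tau> \<noteq> {} \<and> \<tau> \<subseteq> \<sigma> \<longrightarrow> \<tau> \<in> K)"

definition inclusion_on :: "'s set set \<Rightarrow> ('s set \<times> 's set) set" where
  "inclusion_on K = {(\<sigma>, \<sigma>'). \<sigma> \<in> K \<and> \<sigma>' \<in> K \<and> \<sigma> \<subseteq> \<sigma>'}"

record ('s, 'a) msimp =
  Verts :: "'s set"
  Simps :: "'s set set"
  slabel :: "'s set \<times> 's set \<Rightarrow> 'a"

type_synonym ('s, 't, 'a) simp_mor = "('s \<Rightarrow> 't) \<times> ('s set \<Rightarrow> 'a)"

definition monomial_complex :: "('a, 'b) monoid_scheme \<Rightarrow> ('s, 'a) msimp \<Rightarrow> bool" where
  "monomial_complex A X \<longleftrightarrow>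
     simplicial_complex_on (Verts X) (Simps X) \<and>
     slabel X \<in> inclusion_on (Simps X) \<rightarrow>\<^sub>E carrier A \<and>
     (\<forall>\<sigma>\<in>Simps X. \<forall>\<sigma>'\<in>Simps X. \<forall>\<sigma>''\<in>Simps X. \<sigma> \<subseteq> \<sigma>' \<and> \<sigma>' \<subseteq> \<sigma>'' \<longrightarrow>
        slabel X (\<sigma>', \<sigma>'') \<otimes>\<^bsub>A\<^esub> slabel X (\<sigma>, \<sigma>') = slabel X (\<sigma>, \<sigma>'')) \<and>
     (\<forall>\<sigma>\<in>Simps X. slabel X (\<sigma>, \<sigma>) = \<one>\<^bsub>A\<^esub>)"

definition simp_hom ::
  "('a, 'b) monoid_scheme \<Rightarrow> ('s, 'a) msimp \<Rightarrow> ('t, 'a) msimp \<Rightarrow> ('s, 't, 'a) simp_mor set" where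
  "simp_hom A X Y = {(f, u).
     f \<in> Verts X \<rightarrow>\<^sub>E Verts Y \<and>
     (\<forall>\<sigma>\<in>Simps X. f ` \<sigma> \<in> Simps Y) \<and>
     u \<in> Simps X \<rightarrow>\<^sub>E carrier A \<and>
     (\<forall>\<sigma>\<in>Simps X. \<forall>\<sigma>'\<in>Simps X. \<sigma> \<subseteq> \<sigma>' \<longrightarrow>
        slabel Y (f ` \<sigma>, f ` \<sigma>') \<otimes>\<^bsub>A\<^esub> u \<sigma> = u \<sigma>' \<otimes>\<^bsub>A\<^esub> slabel X (\<sigma>, \<sigma>'))}"

definition simp_comp ::
  "('a, 'b) monoid_scheme \<Rightarrow> ('s, 'a) msimp \<Rightarrow>
   ('t, 'r, 'a) simp_mor \<Rightarrow> ('s, 't, 'a) simp_mor \<Rightarrow> ('s, 'r, 'a) simp_mor" where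
  "simp_comp A X = (\<lambda>(e, v) (f, u).
     (\<lambda>x\<in>Verts X. e (f x), \<lambda>\<sigma>\<in>Simps X. v (f ` \<sigma>) \<otimes>\<^bsub>A\<^esub> u \<sigma>))"

text \<open>
  A type variable serves as the universe of vertices; the matching universe for posets is
  \<open>'s set\<close>, where the simplices live.
\<close>

definition Simp_cat :: "('a, 'b) monoid_scheme \<Rightarrow> (('s, 'a) msimp, ('s, 's, 'a) simp_mor) cat" where
  "Simp_cat A =
     \<lparr> Obj = {X. monomial_complex A X},
       Hom = simp_hom A,
       Comp = (\<lambda>X Y Z. simp_comp A X),
       Ident = (\<lambda>X. (\<lambda>x\<in>Verts X. x, \<lambda>\<sigma>\<in>Simps X. \<one>\<^bsub>A\<^esub>)) \<rparr>"

definition contiguous ::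
  "('a, 'b) monoid_scheme \<Rightarrow> ('s, 'a) msimp \<Rightarrow> ('t, 'a) msimp \<Rightarrow>
   ('s, 't, 'a) simp_mor \<Rightarrow> ('s, 't, 'a) simp_mor \<Rightarrow> bool" where
  "contiguous A X Y = (\<lambda>(f, u) (f', u').
     \<forall>\<sigma>\<in>Simps X. f ` \<sigma> \<union> f' ` \<sigma> \<in> Simps Y \<and>
       slabel Y (f ` \<sigma>, f ` \<sigma> \<union> f' ` \<sigma>) \<otimes>\<^bsub>A\<^esub> u \<sigma> =
       slabel Y (f' ` \<sigma>, f ` \<sigma> \<union> f' ` \<sigma>) \<otimes>\<^bsub>A\<^esub> u' \<sigma>)"

definition simp_homotopy ::
  "('a, 'b) monoid_scheme \<Rightarrow> ('s, 'a) msimp \<Rightarrow> ('t, 'a) msimp \<Rightarrow>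
   (('s, 't, 'a) simp_mor \<times> ('s, 't, 'a) simp_mor) set" where
  "simp_homotopy A X Y =
     {(p, q). p \<in> simp_hom A X Y \<and> q \<in> simp_hom A X Y \<and> contiguous A X Y p q}\<^sup>+"

abbreviation finite_complex :: "('s, 'a) msimp \<Rightarrow> bool" where
  "finite_complex X \<equiv> finite (Verts X)"

abbreviation finite_poset :: "('x, 'a) mposet \<Rightarrow> bool" where
  "finite_poset X \<equiv> finite (Elts X)"

definition simp_cat :: "('a, 'b) monoid_scheme \<Rightarrow> (('s, 'a) msimp, ('s, 's, 'a) simp_mor) cat" where
  "simp_cat A = full_subcat (Simp_cat A) finite_complex"

definition H_Simp :: "('a, 'b) monoid_scheme \<Rightarrow> (('s, 'a) msimp, ('s, 's, 'a) simp_mor set) cat" where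
  "H_Simp A = quotient_cat (Simp_cat A) (simp_homotopy A)"

definition H_Poset :: "('a, 'b) monoid_scheme \<Rightarrow> (('x, 'a) mposet, ('x, 'x, 'a) poset_mor set) cat" where
  "H_Poset A = quotient_cat (Poset_cat A) (poset_homotopy A)"

definition H_simp :: "('a, 'b) monoid_scheme \<Rightarrow> (('s, 'a) msimp, ('s, 's, 'a) simp_mor set) cat" where
  "H_simp A = full_subcat (H_Simp A) finite_complex"

definition H_poset :: "('a, 'b) monoid_scheme \<Rightarrow> (('x, 'a) mposet, ('x, 'x, 'a) poset_mor set) cat" where
  "H_poset A = full_subcat (H_Poset A) finite_poset"

definition Q_Simp ::
  "('a, 'b) monoid_scheme \<Rightarrow>
   (('s, 'a) msimp, ('s, 's, 'a) simp_mor, ('s, 'a) msimp, ('s, 's, 'a) simp_mor set) cat_functor" where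
  "Q_Simp A = quotient_functor (simp_homotopy A)"

definition Q_Poset ::
  "('a, 'b) monoid_scheme \<Rightarrow>
   (('x, 'a) mposet, ('x, 'x, 'a) poset_mor, ('x, 'a) mposet, ('x, 'x, 'a) poset_mor set) cat_functor" where
  "Q_Poset A = quotient_functor (poset_homotopy A)"

definition Pi_obj :: "('s, 'a) msimp \<Rightarrow> ('s set, 'a) mposet" where
  "Pi_obj X = \<lparr> Elts = Simps X, Leq = inclusion_on (Simps X), plabel = slabel X \<rparr>"

definition Pi_mor :: "('s, 'a) msimp \<Rightarrow> ('s, 't, 'a) simp_mor \<Rightarrow> ('s set, 't set, 'a) poset_mor" where
  "Pi_mor X = (\<lambda>(f, u). (\<lambda>\<sigma>\<in>Simps X. f ` \<sigma>, u))"

definition Pi_functor ::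
  "(('s, 'a) msimp, ('s, 's, 'a) simp_mor, ('s set, 'a) mposet, ('s set, 's set, 'a) poset_mor) cat_functor" where
  "Pi_functor = \<lparr> fobj = Pi_obj, fmor = (\<lambda>X Y. Pi_mor X) \<rparr>"

end

theory Submission
  imports Defs
begin

text \<open>
  A contiguity between \<open>(f, u)\<close> and \<open>(f', u')\<close> becomes a zigzag in the poset of simplices:
  with \<open>h \<sigma> = f \<sigma> \<union> f' \<sigma>\<close> and \<open>w \<sigma> = m(f \<sigma>, h \<sigma>) u(\<sigma>) = m(f' \<sigma>, h \<sigma>) u'(\<sigma>)\<close>, the pair \<open>(h, w)\<close> is
  a morphism of monomial posets lying above both \<open>\<Pi>(f, u)\<close> and \<open>\<Pi>(f', u')\<close>. It need not come from
  a simplicial map. The rest is the universal property of the quotient by a congruence.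
\<close>

section \<open>Quotients of categories\<close>

text \<open>Both factors may be replaced at once, which is what makes the union in
  \<open>quotient_cat\<close> a single class.\<close>

definition hom_congruence :: "('o, 'm) cat \<Rightarrow> ('o \<Rightarrow> 'o \<Rightarrow> ('m \<times> 'm) set) \<Rightarrow> bool" where
  "hom_congruence C R \<longleftrightarrow>
     (\<forall>X\<in>Obj C. \<forall>Y\<in>Obj C. equiv (Hom C X Y) (R X Y)) \<and>
     (\<forall>X\<in>Obj C. \<forall>Y\<in>Obj C. \<forall>Z\<in>Obj C. \<forall>f f' g g'. (f, f') \<in> R X Y \<longrightarrow> (g, g') \<in> R Y Z \<longrightarrow>
        (Comp C X Y Z g f, Comp C X Y Z g' f') \<in> R X Z)"

lemma hom_congruence_equiv:
  "hom_congruence C R \<Longrightarrow> X \<in> Obj C \<Longrightarrow> Y \<in> Obj C \<Longrightarrow> equiv (Hom C X Y) (R X Y)"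
  by (simp add: hom_congruence_def)

lemma hom_congruence_class_eq:
  assumes "hom_congruence C R" "X \<in> Obj C" "Y \<in> Obj C" "(f, f') \<in> R X Y"
  shows "R X Y `` {f} = R X Y `` {f'}"
  by (rule equiv_class_eq[OF hom_congruence_equiv[OF assms(1-3)] assms(4)])

lemma hom_congruence_self:
  assumes "hom_congruence C R" "X \<in> Obj C" "Y \<in> Obj C" "f \<in> Hom C X Y"
  shows "f \<in> R X Y `` {f}"
  by (rule equiv_class_self[OF hom_congruence_equiv[OF assms(1-3)] assms(4)])

text \<open>The composite is a union over all representatives. By congruence every member of the
  union is the same class, and by reflexivity there is at least one pair of representatives, so the
  union is neither larger than that class nor empty.\<close>

lemma Comp_quotient_cat_class:
  assumes R: "hom_congruence C R" and X: "X \<in> Obj C" and Y: "Y \<in> Obj C" and Z: "Z \<in> Obj C"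
    and f: "f \<in> Hom C X Y" and g: "g \<in> Hom C Y Z"
  shows "Comp (quotient_cat C R) X Y Z (R Y Z `` {g}) (R X Y `` {f}) = R X Z `` {Comp C X Y Z g f}"
proof -
  have "R X Z `` {Comp C X Y Z g' f'} = R X Z `` {Comp C X Y Z g f}"
    if "g' \<in> R Y Z `` {g}" "f' \<in> R X Y `` {f}" for g' f'
  proof -
    have "(Comp C X Y Z g f, Comp C X Y Z g' f') \<in> R X Z"
      using that R X Y Z by (simp add: hom_congruence_def)
    then show ?thesis
      using hom_congruence_class_eq[OF R X Z] by blast
  qed
  moreover have "g \<in> R Y Z `` {g}" "f \<in> R X Y `` {f}"
    using hom_congruence_self R X Y Z f g by metis+
  ultimately show ?thesis
    unfolding quotient_cat_def cat.simps by blast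
qed

lemma Hom_quotient_catE:
  assumes "c \<in> Hom (quotient_cat C R) X Y"
  obtains f where "f \<in> Hom C X Y" "c = R X Y `` {f}"
  using assms by (auto simp: quotient_cat_def elim: quotientE)

lemma Hom_quotient_catI: "f \<in> Hom C X Y \<Longrightarrow> R X Y `` {f} \<in> Hom (quotient_cat C R) X Y"
  by (simp add: quotient_cat_def quotientI)

lemma Obj_quotient_cat [simp]: "Obj (quotient_cat C R) = Obj C"
  by (simp add: quotient_cat_def)

lemma Ident_quotient_cat [simp]: "Ident (quotient_cat C R) X = R X X `` {Ident C X}"
  by (simp add: quotient_cat_def)

lemma is_category_Ident: "is_category C \<Longrightarrow> X \<in> Obj C \<Longrightarrow> Ident C X \<in> Hom C X X"
  by (simp add: is_category_def)

lemma is_category_Comp: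
  "is_category C \<Longrightarrow> X \<in> Obj C \<Longrightarrow> Y \<in> Obj C \<Longrightarrow> Z \<in> Obj C \<Longrightarrow>
   f \<in> Hom C X Y \<Longrightarrow> g \<in> Hom C Y Z \<Longrightarrow> Comp C X Y Z g f \<in> Hom C X Z"
  by (simp add: is_category_def)

lemma is_category_unit:
  assumes "is_category C" "X \<in> Obj C" "Y \<in> Obj C" "f \<in> Hom C X Y"
  shows "Comp C X X Y f (Ident C X) = f" "Comp C X Y Y (Ident C Y) f = f"
  using assms by (simp_all add: is_category_def)

lemma is_category_assoc:
  "is_category C \<Longrightarrow> W \<in> Obj C \<Longrightarrow> X \<in> Obj C \<Longrightarrow> Y \<in> Obj C \<Longrightarrow> Z \<in> Obj C \<Longrightarrow>
   f \<in> Hom C W X \<Longrightarrow> g \<in> Hom C X Y \<Longrightarrow> h \<in> Hom C Y Z \<Longrightarrow>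
   Comp C W Y Z h (Comp C W X Y g f) = Comp C W X Z (Comp C X Y Z h g) f"
  by (simp add: is_category_def)

text \<open>Every morphism of the quotient is the class of some morphism of \<open>C\<close>. Once
  representatives are chosen, \<open>Comp_quotient_cat_class\<close> reduces each law to the same
  law in \<open>C\<close>.\<close>

lemma is_category_quotient_cat:
  assumes C: "is_category C" and R: "hom_congruence C R"
  shows "is_category (quotient_cat C R)"
  unfolding is_category_def Obj_quotient_cat
proof (intro conjI ballI)
  fix X assume "X \<in> Obj C"
  then show "Ident (quotient_cat C R) X \<in> Hom (quotient_cat C R) X X"
    by (simp add: Hom_quotient_catI is_category_Ident C)
next
  fix X Y Z f g
  assume "X \<in> Obj C" "Y \<in> Obj C" "Z \<in> Obj C"
    "f \<in> Hom (quotient_cat C R) X Y" "g \<in> Hom (quotient_cat C R) Y Z"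
  then show "Comp (quotient_cat C R) X Y Z g f \<in> Hom (quotient_cat C R) X Z"
    by (auto elim!: Hom_quotient_catE
        simp: Comp_quotient_cat_class[OF R] Hom_quotient_catI is_category_Comp[OF C])
next
  fix X Y f
  assume "X \<in> Obj C" "Y \<in> Obj C" "f \<in> Hom (quotient_cat C R) X Y"
  then show "Comp (quotient_cat C R) X X Y f (Ident (quotient_cat C R) X) = f"
    and "Comp (quotient_cat C R) X Y Y (Ident (quotient_cat C R) Y) f = f"
    by (auto elim!: Hom_quotient_catE
        simp: Comp_quotient_cat_class[OF R] is_category_Ident[OF C] is_category_unit[OF C])
next
  fix W X Y Z f g h
  assume "W \<in> Obj C" "X \<in> Obj C" "Y \<in> Obj C" "Z \<in> Obj C"
    "f \<in> Hom (quotient_cat C R) W X" "g \<in> Hom (quotient_cat C R) X Y"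
    "h \<in> Hom (quotient_cat C R) Y Z"
  then show "Comp (quotient_cat C R) W Y Z h (Comp (quotient_cat C R) W X Y g f) =
      Comp (quotient_cat C R) W X Z (Comp (quotient_cat C R) X Y Z h g) f"
    by (auto elim!: Hom_quotient_catE
        simp: Comp_quotient_cat_class[OF R] is_category_Comp[OF C] is_category_assoc[OF C])
qed

section \<open>Functors into and between quotient categories\<close>

lemma is_functor_quotient_functor:
  assumes C: "is_category C" and R: "hom_congruence C R"
  shows "is_functor C (quotient_cat C R) (quotient_functor R)"
  using is_category_quotient_cat[OF C R] C
  by (simp add: is_functor_def quotient_functor_def Hom_quotient_catI Comp_quotient_cat_class[OF R])

lemma is_functor_functor_comp:
  "is_functor C D F \<Longrightarrow> is_functor D E G \<Longrightarrow> is_functor C E (functor_comp G F)"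
  by (simp add: is_functor_def functor_comp_def)

text \<open>As in \<open>quotient_cat\<close>, a union over representatives replaces a choice among
  them. It is a single class as soon as \<open>F\<close> sends related morphisms to related
  ones.\<close>

definition induced_functor ::
  "('p \<Rightarrow> 'p \<Rightarrow> ('n \<times> 'n) set) \<Rightarrow> ('o, 'm, 'p, 'n) cat_functor \<Rightarrow> ('o, 'm set, 'p, 'n set) cat_functor" where
  "induced_functor S F =
     \<lparr> fobj = fobj F,
       fmor = (\<lambda>X Y c. \<Union>f\<in>c. S (fobj F X) (fobj F Y) `` {fmor F X Y f}) \<rparr>"

lemma fobj_induced_functor [simp]: "fobj (induced_functor S F) = fobj F"
  by (simp add: induced_functor_def)

text \<open>The setting for the universal property of the quotient. \<open>RS\<close> is the
  condition that makes \<open>induced_functor\<close> independent of representatives; for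
  \<open>Pi_functor\<close> it is the homotopy invariance to be proved.\<close>

locale congruence_functor =
  fixes C :: "('o, 'm) cat" and D :: "('p, 'n) cat" and R S and F :: "('o, 'm, 'p, 'n) cat_functor"
  assumes F: "is_functor C D F"
    and R: "hom_congruence C R" and S: "hom_congruence D S"
    and RS: "X \<in> Obj C \<Longrightarrow> Y \<in> Obj C \<Longrightarrow> (f, g) \<in> R X Y \<Longrightarrow>
      (fmor F X Y f, fmor F X Y g) \<in> S (fobj F X) (fobj F Y)"
begin

lemma categories: "is_category C" "is_category D"
  using F by (simp_all add: is_functor_def)

lemma functor_simps:
  "X \<in> Obj C \<Longrightarrow> fobj F X \<in> Obj D"
  "X \<in> Obj C \<Longrightarrow> Y \<in> Obj C \<Longrightarrow> f \<in> Hom C X Y \<Longrightarrow> fmor F X Y f \<in> Hom D (fobj F X) (fobj F Y)"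
  "X \<in> Obj C \<Longrightarrow> fmor F X X (Ident C X) = Ident D (fobj F X)"
  "X \<in> Obj C \<Longrightarrow> Y \<in> Obj C \<Longrightarrow> Z \<in> Obj C \<Longrightarrow> f \<in> Hom C X Y \<Longrightarrow> g \<in> Hom C Y Z \<Longrightarrow>
    fmor F X Z (Comp C X Y Z g f) =
      Comp D (fobj F X) (fobj F Y) (fobj F Z) (fmor F Y Z g) (fmor F X Y f)"
  using F by (simp_all add: is_functor_def)

text \<open>By \<open>RS\<close> all members of the union coincide, and \<open>f\<close> belongs to
  its own class, so the union is not empty.\<close>

lemma fmor_induced_functor_class:
  assumes X: "X \<in> Obj C" and Y: "Y \<in> Obj C" and f: "f \<in> Hom C X Y"
  shows "fmor (induced_functor S F) X Y (R X Y `` {f}) = S (fobj F X) (fobj F Y) `` {fmor F X Y f}"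
proof -
  have "S (fobj F X) (fobj F Y) `` {fmor F X Y g} = S (fobj F X) (fobj F Y) `` {fmor F X Y f}"
    if "g \<in> R X Y `` {f}" for g
    using hom_congruence_class_eq[OF S functor_simps(1)[OF X] functor_simps(1)[OF Y]] RS[OF X Y] that
    by blast
  moreover have "f \<in> R X Y `` {f}"
    by (rule hom_congruence_self[OF R X Y f])
  ultimately show ?thesis
    unfolding induced_functor_def cat_functor.simps by blast
qed

lemma is_functor_induced_functor:
  "is_functor (quotient_cat C R) (quotient_cat D S) (induced_functor S F)"
  unfolding is_functor_def Obj_quotient_cat fobj_induced_functor Ident_quotient_cat
proof (intro conjI ballI)
  show "is_category (quotient_cat C R)" "is_category (quotient_cat D S)"
    using categories R S by (simp_all add: is_category_quotient_cat)
next
  fix X assume "X \<in> Obj C"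
  then show "fobj F X \<in> Obj D"
    and "fmor (induced_functor S F) X X (R X X `` {Ident C X}) =
      S (fobj F X) (fobj F X) `` {Ident D (fobj F X)}"
    by (simp_all add: functor_simps fmor_induced_functor_class is_category_Ident categories)
next
  fix X Y c
  assume "X \<in> Obj C" "Y \<in> Obj C" "c \<in> Hom (quotient_cat C R) X Y"
  then show "fmor (induced_functor S F) X Y c \<in> Hom (quotient_cat D S) (fobj F X) (fobj F Y)"
    by (auto elim!: Hom_quotient_catE
        simp: fmor_induced_functor_class Hom_quotient_catI functor_simps)
next
  fix X Y Z c d
  assume "X \<in> Obj C" "Y \<in> Obj C" "Z \<in> Obj C"
    "c \<in> Hom (quotient_cat C R) X Y" "d \<in> Hom (quotient_cat C R) Y Z"
  then show "fmor (induced_functor S F) X Z (Comp (quotient_cat C R) X Y Z d c) =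
      Comp (quotient_cat D S) (fobj F X) (fobj F Y) (fobj F Z)
        (fmor (induced_functor S F) Y Z d) (fmor (induced_functor S F) X Y c)"
    by (auto elim!: Hom_quotient_catE
        simp: fmor_induced_functor_class Comp_quotient_cat_class[OF R] Comp_quotient_cat_class[OF S]
          functor_simps is_category_Comp categories)
qed

text \<open>On morphisms this is \<open>fmor_induced_functor_class\<close> read from right to left
  or left to right. \<open>equal_functors\<close> also demands that both sides be functors, and that
  is where the work lies.\<close>

lemma induced_functor_quotient_functor:
  "equal_functors C (quotient_cat D S)
     (functor_comp (induced_functor S F) (quotient_functor R))
     (functor_comp (quotient_functor S) F)"
  unfolding equal_functors_def
proof (intro conjI ballI)
  show "is_functor C (quotient_cat D S) (functor_comp (induced_functor S F) (quotient_functor R))"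
    using is_functor_quotient_functor[OF categories(1) R] is_functor_induced_functor
    by (rule is_functor_functor_comp)
  show "is_functor C (quotient_cat D S) (functor_comp (quotient_functor S) F)"
    using F is_functor_quotient_functor[OF categories(2) S] by (rule is_functor_functor_comp)
qed (simp_all add: functor_comp_def quotient_functor_def fmor_induced_functor_class)

end

section \<open>Restriction to full subcategories\<close>

lemma is_category_full_subcat: "is_category C \<Longrightarrow> is_category (full_subcat C P)"
  by (simp add: is_category_def full_subcat_def)

text \<open>A full subcategory keeps the hom-sets, composition and identities of the ambient
  category, so the functor laws are inherited; the new obligation is that \<open>F\<close> respects
  the selected objects.\<close>

lemma is_functor_full_subcat:
  assumes F: "is_functor C D F" and P: "\<And>X. X \<in> Obj C \<Longrightarrow> P X \<Longrightarrow> P' (fobj F X)"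
  shows "is_functor (full_subcat C P) (full_subcat D P') F"
proof -
  have "is_category (full_subcat C P)" "is_category (full_subcat D P')"
    using F by (simp_all add: is_functor_def is_category_full_subcat)
  then show ?thesis
    \<comment> \<open>The first pass leaves \<open>full_subcat\<close> folded, so that the two
      category facts apply as they stand; the second unfolds it for the remaining laws.\<close>
    using F P by (simp add: is_functor_def) (simp add: full_subcat_def)
qed

lemma equal_functors_full_subcat:
  assumes "equal_functors C D F G" and "\<And>X. X \<in> Obj C \<Longrightarrow> P X \<Longrightarrow> P' (fobj F X)"
  shows "equal_functors (full_subcat C P) (full_subcat D P') F G"
proof -
  have "\<And>X. X \<in> Obj C \<Longrightarrow> P X \<Longrightarrow> P' (fobj G X)"
    using assms by (simp add: equal_functors_def)
  then have "is_functor (full_subcat C P) (full_subcat D P') F"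
    "is_functor (full_subcat C P) (full_subcat D P') G"
    using assms by (auto simp: equal_functors_def intro!: is_functor_full_subcat)
  then show ?thesis
    using assms(1) by (simp add: equal_functors_def) (simp add: full_subcat_def)
qed

section \<open>Congruences generated by chains of elementary steps\<close>

lemma equiv_trancl:
  assumes "r \<subseteq> B \<times> B" "refl_on B r" "sym r"
  shows "equiv B (r\<^sup>+)"
  using trancl_subset_Sigma[OF assms(1)] assms
  by (intro equivI sym_trancl trans_trancl) (auto simp: refl_on_def)

text \<open>Induction along the chain: images of links are chains, and chains concatenate. A link
  may go to a chain of \<open>s\<close> rather than to one link, because a single contiguity will
  become two comparisons of poset morphisms.\<close>

lemma trancl_image:
  assumes "(p, q) \<in> r\<^sup>+" and "\<And>p q. (p, q) \<in> r \<Longrightarrow> (h p, h q) \<in> s\<^sup>+"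
  shows "(h p, h q) \<in> s\<^sup>+"
  using assms(1)
proof (induction rule: trancl_induct)
  case (base q)
  then show ?case by (rule assms(2))
next
  case (step q q')
  then show ?case using assms(2) by (meson trancl_trans)
qed

text \<open>Compatibility need only be checked for one elementary step on one side, with the other
  factor fixed. A general pair of chains is handled by moving \<open>f\<close> to \<open>f'\<close>
  under \<open>g\<close>, then \<open>g\<close> to \<open>g'\<close> over \<open>f'\<close>.\<close>

lemma hom_congruence_trancl:
  assumes C: "is_category C"
    and sub: "\<And>X Y. r X Y \<subseteq> Hom C X Y \<times> Hom C X Y"
    and refl: "\<And>X Y. X \<in> Obj C \<Longrightarrow> Y \<in> Obj C \<Longrightarrow> refl_on (Hom C X Y) (r X Y)"
    and sym: "\<And>X Y. sym (r X Y)"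
    and left: "\<And>X Y Z f f' g. X \<in> Obj C \<Longrightarrow> Y \<in> Obj C \<Longrightarrow> Z \<in> Obj C \<Longrightarrow>
      (f, f') \<in> r X Y \<Longrightarrow> g \<in> Hom C Y Z \<Longrightarrow> (Comp C X Y Z g f, Comp C X Y Z g f') \<in> r X Z"
    and right: "\<And>X Y Z f g g'. X \<in> Obj C \<Longrightarrow> Y \<in> Obj C \<Longrightarrow> Z \<in> Obj C \<Longrightarrow>
      f \<in> Hom C X Y \<Longrightarrow> (g, g') \<in> r Y Z \<Longrightarrow> (Comp C X Y Z g f, Comp C X Y Z g' f) \<in> r X Z"
  shows "hom_congruence C (\<lambda>X Y. (r X Y)\<^sup>+)"
  unfolding hom_congruence_def
proof (intro conjI ballI allI impI)
  fix X Y assume "X \<in> Obj C" "Y \<in> Obj C"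
  then show "equiv (Hom C X Y) ((r X Y)\<^sup>+)"
    by (intro equiv_trancl sub refl sym)
next
  fix X Y Z f f' g g'
  assume XYZ: "X \<in> Obj C" "Y \<in> Obj C" "Z \<in> Obj C"
    and f: "(f, f') \<in> (r X Y)\<^sup>+" and g: "(g, g') \<in> (r Y Z)\<^sup>+"
  \<comment> \<open>These are the two factors held fixed below; chains do not leave the
    hom-set.\<close>
  have "f' \<in> Hom C X Y" "g \<in> Hom C Y Z"
    using f g trancl_subset_Sigma[OF sub] by blast+
  then have "(Comp C X Y Z g f, Comp C X Y Z g f') \<in> (r X Z)\<^sup>+"
    and "(Comp C X Y Z g f', Comp C X Y Z g' f') \<in> (r X Z)\<^sup>+"
    using XYZ by (auto intro: trancl_image[OF f] trancl_image[OF g, where h = "\<lambda>g. Comp C X Y Z g f'"]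
        r_into_trancl left right)
  then show "(Comp C X Y Z g f, Comp C X Y Z g' f') \<in> (r X Z)\<^sup>+"
    by (rule trancl_trans)
qed

section \<open>Monomial posets\<close>

lemma monomial_poset_LeqD:
  assumes "monomial_poset A X" "(x, x') \<in> Leq X"
  shows "x \<in> Elts X" "x' \<in> Elts X" "plabel X (x, x') \<in> carrier A"
  using assms unfolding monomial_poset_def partial_order_on_def preorder_on_def by blast+

lemma monomial_poset_Leq_refl:
  assumes "monomial_poset A X" "x \<in> Elts X"
  shows "(x, x) \<in> Leq X"
  using assms by (auto simp: monomial_poset_def partial_order_on_def preorder_on_def refl_on_def)

lemma plabel_refl: "monomial_poset A X \<Longrightarrow> x \<in> Elts X \<Longrightarrow> plabel X (x, x) = \<one>\<^bsub>A\<^esub>"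
  by (simp add: monomial_poset_def)

lemma poset_homD:
  assumes "(f, u) \<in> poset_hom A X Y"
  shows "f \<in> extensional (Elts X)" "u \<in> extensional (Elts X)"
    "x \<in> Elts X \<Longrightarrow> f x \<in> Elts Y" "x \<in> Elts X \<Longrightarrow> u x \<in> carrier A"
    "(x, x') \<in> Leq X \<Longrightarrow> (f x, f x') \<in> Leq Y"
    "(x, x') \<in> Leq X \<Longrightarrow> plabel Y (f x, f x') \<otimes>\<^bsub>A\<^esub> u x = u x' \<otimes>\<^bsub>A\<^esub> plabel X (x, x')"
  using assms by (auto simp: poset_hom_def PiE_def)

lemma poset_homI:
  assumes "f \<in> extensional (Elts X)" "u \<in> extensional (Elts X)"
    "\<And>x. x \<in> Elts X \<Longrightarrow> f x \<in> Elts Y" "\<And>x. x \<in> Elts X \<Longrightarrow> u x \<in> carrier A"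
    "\<And>x x'. (x, x') \<in> Leq X \<Longrightarrow> (f x, f x') \<in> Leq Y"
    "\<And>x x'. (x, x') \<in> Leq X \<Longrightarrow> plabel Y (f x, f x') \<otimes>\<^bsub>A\<^esub> u x = u x' \<otimes>\<^bsub>A\<^esub> plabel X (x, x')"
  shows "(f, u) \<in> poset_hom A X Y"
  using assms by (auto simp: poset_hom_def PiE_def)

lemma poset_comp_simp:
  "poset_comp A X (e, v) (f, u) = (\<lambda>x\<in>Elts X. e (f x), \<lambda>x\<in>Elts X. v (f x) \<otimes>\<^bsub>A\<^esub> u x)"
  by (simp add: poset_comp_def)

text \<open>A name for one step of a homotopy, so that \<open>poset_homotopy\<close> takes the form
  required by \<open>hom_congruence_trancl\<close>.\<close>

definition poset_comparable ::
  "('a, 'b) monoid_scheme \<Rightarrow> ('x, 'a) mposet \<Rightarrow> ('y, 'a) mposet \<Rightarrow>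
   (('x, 'y, 'a) poset_mor \<times> ('x, 'y, 'a) poset_mor) set" where
  "poset_comparable A X Y =
     {(p, q). p \<in> poset_hom A X Y \<and> q \<in> poset_hom A X Y \<and>
        (poset_hom_le A X Y p q \<or> poset_hom_le A X Y q p)}"

lemma poset_homotopy_eq_trancl: "poset_homotopy A X Y = (poset_comparable A X Y)\<^sup>+"
  by (simp add: poset_homotopy_def poset_comparable_def)

context monoid
begin

text \<open>Two commuting squares are pasted: the label of \<open>Z\<close> is moved past
  \<open>v\<close> by the square of \<open>q\<close> at the pair \<open>(f x, f x')\<close>, then
  the label of \<open>Y\<close> past \<open>u\<close> by the square of \<open>p\<close>.\<close>

lemma poset_comp_closed:
  assumes X: "monomial_poset G X" and Y: "monomial_poset G Y" and Z: "monomial_poset G Z"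
    and p: "p \<in> poset_hom G X Y" and q: "q \<in> poset_hom G Y Z"
  shows "poset_comp G X q p \<in> poset_hom G X Z"
proof -
  obtain f u g v where pq: "p = (f, u)" "q = (g, v)"
    by (cases p, cases q)
  note f = poset_homD[OF p[unfolded pq]] and g = poset_homD[OF q[unfolded pq]]
  show ?thesis
    unfolding pq poset_comp_simp
  proof (rule poset_homI)
    fix x x' assume le: "(x, x') \<in> Leq X"
    note le_elts = monomial_poset_LeqD[OF X le]
    note fle = f(5)[OF le]
    show "(restrict (\<lambda>x. g (f x)) (Elts X) x, restrict (\<lambda>x. g (f x)) (Elts X) x') \<in> Leq Z"
      using le_elts g(5)[OF fle] by simp
    have "plabel Z (g (f x), g (f x')) \<otimes> (v (f x) \<otimes> u x)
        = (plabel Z (g (f x), g (f x')) \<otimes> v (f x)) \<otimes> u x"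
      using le_elts f g monomial_poset_LeqD[OF Z g(5)[OF fle]] by (simp add: m_assoc)
    also have "\<dots> = v (f x') \<otimes> (plabel Y (f x, f x') \<otimes> u x)"
      using le_elts f g monomial_poset_LeqD[OF Y fle] by (simp add: g(6)[OF fle] m_assoc)
    also have "\<dots> = (v (f x') \<otimes> u x') \<otimes> plabel X (x, x')"
      using le_elts f g by (simp add: f(6)[OF le] m_assoc)
    finally show "plabel Z (restrict (\<lambda>x. g (f x)) (Elts X) x, restrict (\<lambda>x. g (f x)) (Elts X) x') \<otimes>
        restrict (\<lambda>x. v (f x) \<otimes> u x) (Elts X) x =
        restrict (\<lambda>x. v (f x) \<otimes> u x) (Elts X) x' \<otimes> plabel X (x, x')"
      using le_elts by simp
  qed (use f g in auto)
qed

lemma is_category_Poset_cat: "is_category (Poset_cat G :: (('x, 'a) mposet, ('x, 'x, 'a) poset_mor) cat)"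
proof -
  have ident: "(\<lambda>x\<in>Elts X. x, \<lambda>x\<in>Elts X. \<one>) \<in> poset_hom G X X"
    if "monomial_poset G X" for X :: "('x, 'a) mposet"
    using monomial_poset_LeqD[OF that] by (intro poset_homI) auto
  \<comment> \<open>The laws hold as equalities of HOL functions because components of morphisms are
    extensional: off \<open>Elts X\<close> both sides are \<open>undefined\<close>.\<close>
  have unit: "poset_comp G X p (\<lambda>x\<in>Elts X. x, \<lambda>x\<in>Elts X. \<one>) = p"
    "poset_comp G X (\<lambda>x\<in>Elts Y. x, \<lambda>x\<in>Elts Y. \<one>) p = p"
    if "p \<in> poset_hom G X Y" for X Y :: "('x, 'a) mposet" and p
    using that
    by (cases p; auto simp: poset_comp_simp poset_homD intro!: extensionalityI[where A = "Elts X"])+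
  have assoc: "poset_comp G W r (poset_comp G W q p) = poset_comp G W (poset_comp G X r q) p"
    if "p \<in> poset_hom G W X" "q \<in> poset_hom G X Y" "r \<in> poset_hom G Y Z"
    for W X Y Z :: "('x, 'a) mposet" and p q r
    using that
    by (cases p; cases q; cases r;
        auto simp: poset_comp_simp poset_homD m_assoc intro!: extensionalityI[where A = "Elts W"])
  show ?thesis
    unfolding is_category_def Poset_cat_def cat.simps mem_Collect_eq
    by (intro conjI ballI) (auto simp: ident unit assoc intro: poset_comp_closed)
qed

lemma poset_hom_le_refl:
  assumes Y: "monomial_poset G Y" and p: "p \<in> poset_hom G X Y"
  shows "poset_hom_le G X Y p p"
  using p by (cases p) (auto simp: poset_hom_le_def poset_homD monomial_poset_Leq_refl[OF Y] plabel_refl[OF Y])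

text \<open>The square of \<open>q\<close> at the pair \<open>(f x, f' x)\<close> trades the label
  of \<open>Z\<close> for that of \<open>Y\<close>, which the given inequality absorbs into
  \<open>u'\<close>.\<close>

lemma poset_hom_le_comp_left:
  assumes Y: "monomial_poset G Y" and Z: "monomial_poset G Z"
    and p: "p \<in> poset_hom G X Y" and q: "q \<in> poset_hom G Y Z" and le: "poset_hom_le G X Y p p'"
  shows "poset_hom_le G X Z (poset_comp G X q p) (poset_comp G X q p')"
proof -
  obtain f u f' u' g v where pq: "p = (f, u)" "p' = (f', u')" "q = (g, v)"
    by (cases p, cases p', cases q)
  note f = poset_homD[OF p[unfolded pq]] and g = poset_homD[OF q[unfolded pq]]
  have "plabel Z (g (f x), g (f' x)) \<otimes> (v (f x) \<otimes> u x) = v (f' x) \<otimes> u' x \<and>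
      (g (f x), g (f' x)) \<in> Leq Z" if x: "x \<in> Elts X" for x
  proof -
    have le': "(f x, f' x) \<in> Leq Y" and u': "plabel Y (f x, f' x) \<otimes> u x = u' x"
      using le x by (auto simp: pq poset_hom_le_def)
    note le_elts = monomial_poset_LeqD[OF Y le']
    have "plabel Z (g (f x), g (f' x)) \<otimes> (v (f x) \<otimes> u x)
        = (plabel Z (g (f x), g (f' x)) \<otimes> v (f x)) \<otimes> u x"
      using x f g le_elts monomial_poset_LeqD[OF Z g(5)[OF le']] by (simp add: m_assoc)
    also have "\<dots> = v (f' x) \<otimes> (plabel Y (f x, f' x) \<otimes> u x)"
      using x f g le_elts by (simp add: g(6)[OF le'] m_assoc)
    finally show ?thesis
      using g(5)[OF le'] by (simp add: u')
  qed
  then show ?thesis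
    by (auto simp: pq poset_comp_simp poset_hom_le_def)
qed

text \<open>The inequality between \<open>q\<close> and \<open>q'\<close> is evaluated at the points
  \<open>f x\<close>; the factor \<open>u x\<close> is multiplied on from the right.\<close>

lemma poset_hom_le_comp_right:
  assumes Z: "monomial_poset G Z"
    and p: "p \<in> poset_hom G X Y" and q: "q \<in> poset_hom G Y Z" and le: "poset_hom_le G Y Z q q'"
  shows "poset_hom_le G X Z (poset_comp G X q p) (poset_comp G X q' p)"
proof -
  obtain f u g v g' v' where pq: "p = (f, u)" "q = (g, v)" "q' = (g', v')"
    by (cases p, cases q, cases q')
  note f = poset_homD[OF p[unfolded pq]] and g = poset_homD[OF q[unfolded pq]]
  have "plabel Z (g (f x), g' (f x)) \<otimes> (v (f x) \<otimes> u x) = v' (f x) \<otimes> u x \<and>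
      (g (f x), g' (f x)) \<in> Leq Z" if x: "x \<in> Elts X" for x
  proof -
    have le': "(g (f x), g' (f x)) \<in> Leq Z"
      and v': "plabel Z (g (f x), g' (f x)) \<otimes> v (f x) = v' (f x)"
      using le f(3)[OF x] by (auto simp: pq poset_hom_le_def)
    show ?thesis
      using x f g monomial_poset_LeqD[OF Z le'] le' by (simp add: m_assoc flip: v')
  qed
  then show ?thesis
    by (auto simp: pq poset_comp_simp poset_hom_le_def)
qed

lemma hom_congruence_poset_homotopy: "hom_congruence (Poset_cat G) (poset_homotopy G)"
  \<comment> \<open>The abstracted equation also rewrites the partially applied
    \<open>poset_homotopy G\<close>, exposing a family of transitive closures. Cases 2 to 5 are
    reflexivity, symmetry and the two one-sided compatibilities; containment in the hom-set is
    closed last.\<close>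
  unfolding poset_homotopy_eq_trancl[abs_def]
proof (rule hom_congruence_trancl[OF is_category_Poset_cat], goal_cases)
  case 2
  then show ?case
    by (auto simp: Poset_cat_def refl_on_def poset_comparable_def intro: poset_hom_le_refl)
next
  case 3
  then show ?case
    by (auto simp: sym_def poset_comparable_def)
next
  case 4
  then show ?case
    by (auto simp: Poset_cat_def poset_comparable_def intro: poset_comp_closed poset_hom_le_comp_left)
next
  case 5
  then show ?case
    by (auto simp: Poset_cat_def poset_comparable_def intro: poset_comp_closed poset_hom_le_comp_right)
qed (auto simp: Poset_cat_def poset_comparable_def)

end

section \<open>Monomial simplicial complexes\<close>

lemma monomial_complexD:
  assumes "monomial_complex A X"
  shows "simplicial_complex_on (Verts X) (Simps X)"
    "slabel X \<in> inclusion_on (Simps X) \<rightarrow>\<^sub>E carrier A"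
    "\<forall>\<rho>\<in>Simps X. \<forall>\<sigma>\<in>Simps X. \<forall>\<tau>\<in>Simps X. \<rho> \<subseteq> \<sigma> \<and> \<sigma> \<subseteq> \<tau> \<longrightarrow>
      slabel X (\<sigma>, \<tau>) \<otimes>\<^bsub>A\<^esub> slabel X (\<rho>, \<sigma>) = slabel X (\<rho>, \<tau>)"
    "\<forall>\<sigma>\<in>Simps X. slabel X (\<sigma>, \<sigma>) = \<one>\<^bsub>A\<^esub>"
  using assms[unfolded monomial_complex_def] by - (elim conjE, assumption)+

lemma monomial_complex_SimpsD:
  assumes "monomial_complex A X" "\<sigma> \<in> Simps X"
  shows "\<sigma> \<subseteq> Verts X"
  using monomial_complexD(1)[OF assms(1)] assms(2) by (simp add: simplicial_complex_on_def)

lemma slabel_closed: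
  assumes "monomial_complex A X" "\<sigma> \<in> Simps X" "\<tau> \<in> Simps X" "\<sigma> \<subseteq> \<tau>"
  shows "slabel X (\<sigma>, \<tau>) \<in> carrier A"
  by (rule PiE_mem[OF monomial_complexD(2)[OF assms(1)]]) (use assms in \<open>simp add: inclusion_on_def\<close>)

lemma slabel_trans:
  assumes "monomial_complex A X" "\<rho> \<in> Simps X" "\<sigma> \<in> Simps X" "\<tau> \<in> Simps X" "\<rho> \<subseteq> \<sigma>" "\<sigma> \<subseteq> \<tau>"
  shows "slabel X (\<sigma>, \<tau>) \<otimes>\<^bsub>A\<^esub> slabel X (\<rho>, \<sigma>) = slabel X (\<rho>, \<tau>)"
  using monomial_complexD(3)[OF assms(1)] assms(2-) by simp

lemma simp_homD:
  assumes "(f, u) \<in> simp_hom A X Y"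
  shows "f \<in> extensional (Verts X)" "u \<in> extensional (Simps X)"
    "x \<in> Verts X \<Longrightarrow> f x \<in> Verts Y" "\<sigma> \<in> Simps X \<Longrightarrow> f ` \<sigma> \<in> Simps Y"
    "\<sigma> \<in> Simps X \<Longrightarrow> u \<sigma> \<in> carrier A"
    "\<sigma> \<in> Simps X \<Longrightarrow> \<tau> \<in> Simps X \<Longrightarrow> \<sigma> \<subseteq> \<tau> \<Longrightarrow>
      slabel Y (f ` \<sigma>, f ` \<tau>) \<otimes>\<^bsub>A\<^esub> u \<sigma> = u \<tau> \<otimes>\<^bsub>A\<^esub> slabel X (\<sigma>, \<tau>)"
  using assms by (auto simp: simp_hom_def PiE_def)

lemma simp_homI:
  assumes "f \<in> extensional (Verts X)" "u \<in> extensional (Simps X)"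
    "\<And>x. x \<in> Verts X \<Longrightarrow> f x \<in> Verts Y" "\<And>\<sigma>. \<sigma> \<in> Simps X \<Longrightarrow> f ` \<sigma> \<in> Simps Y"
    "\<And>\<sigma>. \<sigma> \<in> Simps X \<Longrightarrow> u \<sigma> \<in> carrier A"
    "\<And>\<sigma> \<tau>. \<sigma> \<in> Simps X \<Longrightarrow> \<tau> \<in> Simps X \<Longrightarrow> \<sigma> \<subseteq> \<tau> \<Longrightarrow>
      slabel Y (f ` \<sigma>, f ` \<tau>) \<otimes>\<^bsub>A\<^esub> u \<sigma> = u \<tau> \<otimes>\<^bsub>A\<^esub> slabel X (\<sigma>, \<tau>)"
  shows "(f, u) \<in> simp_hom A X Y"
  using assms by (auto simp: simp_hom_def PiE_def)

lemma simp_comp_simp: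
  "simp_comp A X (e, v) (f, u) = (\<lambda>x\<in>Verts X. e (f x), \<lambda>\<sigma>\<in>Simps X. v (f ` \<sigma>) \<otimes>\<^bsub>A\<^esub> u \<sigma>)"
  by (simp add: simp_comp_def)

text \<open>A simplex consists of vertices, so the default value of \<open>restrict\<close> never
  enters the image.\<close>

lemma image_restrict_simplex:
  assumes "monomial_complex A X" "\<sigma> \<in> Simps X"
  shows "(\<lambda>x\<in>Verts X. f x) ` \<sigma> = f ` \<sigma>"
  using monomial_complex_SimpsD[OF assms] by (intro image_cong) auto

lemma image_restrict_comp_simplex:
  assumes "monomial_complex A X" "\<sigma> \<in> Simps X"
  shows "(\<lambda>x\<in>Verts X. g (f x)) ` \<sigma> = g ` f ` \<sigma>"
  using image_restrict_simplex[OF assms, of "\<lambda>x. g (f x)"] by (simp add: image_image)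

definition contiguity ::
  "('a, 'b) monoid_scheme \<Rightarrow> ('s, 'a) msimp \<Rightarrow> ('t, 'a) msimp \<Rightarrow>
   (('s, 't, 'a) simp_mor \<times> ('s, 't, 'a) simp_mor) set" where
  "contiguity A X Y =
     {(p, q). p \<in> simp_hom A X Y \<and> q \<in> simp_hom A X Y \<and> contiguous A X Y p q}"

lemma simp_homotopy_eq_trancl: "simp_homotopy A X Y = (contiguity A X Y)\<^sup>+"
  by (simp add: simp_homotopy_def contiguity_def)

lemma contiguous_refl: "p \<in> simp_hom A X Y \<Longrightarrow> contiguous A X Y p p"
  by (cases p) (auto simp: contiguous_def simp_homD)

lemma contiguous_sym: "contiguous A X Y p q \<Longrightarrow> contiguous A X Y q p"
  by (cases p; cases q) (simp add: contiguous_def Un_commute)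

context monoid
begin

text \<open>The same pasting of squares as for posets, now along inclusions of simplices and their
  images.\<close>

lemma simp_comp_closed:
  assumes X: "monomial_complex G X" and Y: "monomial_complex G Y" and Z: "monomial_complex G Z"
    and p: "p \<in> simp_hom G X Y" and q: "q \<in> simp_hom G Y Z"
  shows "simp_comp G X q p \<in> simp_hom G X Z"
proof -
  obtain f u g v where pq: "p = (f, u)" "q = (g, v)"
    by (cases p, cases q)
  note f = simp_homD[OF p[unfolded pq]] and g = simp_homD[OF q[unfolded pq]]
  note img = image_restrict_comp_simplex[OF X]
  show ?thesis
    unfolding pq simp_comp_simp
  proof (rule simp_homI)
    fix \<sigma> \<tau> assume st: "\<sigma> \<in> Simps X" "\<tau> \<in> Simps X" "\<sigma> \<subseteq> \<tau>"
    note fst = f(4)[OF st(1)] f(4)[OF st(2)] image_mono[OF st(3), of f]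
    have "slabel Z (g ` f ` \<sigma>, g ` f ` \<tau>) \<otimes> (v (f ` \<sigma>) \<otimes> u \<sigma>)
        = (slabel Z (g ` f ` \<sigma>, g ` f ` \<tau>) \<otimes> v (f ` \<sigma>)) \<otimes> u \<sigma>"
      by (intro m_assoc[symmetric] slabel_closed[OF Z] f g st fst image_mono)
    also have "\<dots> = v (f ` \<tau>) \<otimes> (slabel Y (f ` \<sigma>, f ` \<tau>) \<otimes> u \<sigma>)"
      using st fst f g slabel_closed[OF Y] by (simp add: g(6)[OF fst] m_assoc)
    also have "\<dots> = (v (f ` \<tau>) \<otimes> u \<tau>) \<otimes> slabel X (\<sigma>, \<tau>)"
      using st fst f g slabel_closed[OF X] by (simp add: f(6)[OF st] m_assoc)
    finally show "slabel Z (restrict (\<lambda>x. g (f x)) (Verts X) ` \<sigma>, restrict (\<lambda>x. g (f x)) (Verts X) ` \<tau>) \<otimes>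
        restrict (\<lambda>\<sigma>. v (f ` \<sigma>) \<otimes> u \<sigma>) (Simps X) \<sigma> =
        restrict (\<lambda>\<sigma>. v (f ` \<sigma>) \<otimes> u \<sigma>) (Simps X) \<tau> \<otimes> slabel X (\<sigma>, \<tau>)"
      \<comment> \<open>Removing \<open>image_cong_simp\<close> keeps the simplifier from rewriting
        the restricted map pointwise under the image, so that \<open>img\<close> matches it as a
        whole.\<close>
      using st by (simp add: img cong del: image_cong_simp)
  qed (use f g in \<open>auto simp: img cong del: image_cong_simp\<close>)
qed

lemma is_category_Simp_cat: "is_category (Simp_cat G :: (('x, 'a) msimp, ('x, 'x, 'a) simp_mor) cat)"
proof -
  have ident: "(\<lambda>x\<in>Verts X. x, \<lambda>\<sigma>\<in>Simps X. \<one>) \<in> simp_hom G X X"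
    if "monomial_complex G X" for X :: "('x, 'a) msimp"
    using slabel_closed[OF that] by (intro simp_homI) (auto simp: image_restrict_simplex[OF that] cong del: image_cong_simp)
  have unit: "simp_comp G X p (\<lambda>x\<in>Verts X. x, \<lambda>\<sigma>\<in>Simps X. \<one>) = p"
    "simp_comp G X (\<lambda>x\<in>Verts Y. x, \<lambda>\<sigma>\<in>Simps Y. \<one>) p = p"
    if "monomial_complex G X" "p \<in> simp_hom G X Y" for X Y :: "('x, 'a) msimp" and p
    using that(2)
    by (cases p; auto simp: simp_comp_simp simp_homD image_restrict_simplex[OF that(1)]
        cong del: image_cong_simp
        intro!: extensionalityI[where A = "Verts X"] extensionalityI[where A = "Simps X"])+
  have assoc: "simp_comp G W r (simp_comp G W q p) = simp_comp G W (simp_comp G X r q) p"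
    if "monomial_complex G W" "p \<in> simp_hom G W X" "q \<in> simp_hom G X Y" "r \<in> simp_hom G Y Z"
    for W X Y Z :: "('x, 'a) msimp" and p q r
    using that(2-)
    by (cases p; cases q; cases r;
        auto simp: simp_comp_simp simp_homD m_assoc image_restrict_comp_simplex[OF that(1)]
        cong del: image_cong_simp
        intro!: extensionalityI[where A = "Verts W"] extensionalityI[where A = "Simps W"])
  show ?thesis
    unfolding is_category_def Simp_cat_def cat.simps mem_Collect_eq
    by (intro conjI ballI) (auto simp: ident unit assoc intro: simp_comp_closed)
qed

text \<open>Images commute with unions, so the simplex joining the two composites is the image under
  \<open>g\<close> of the one joining \<open>f\<close> and \<open>f'\<close>. The square of
  \<open>q\<close> at the inclusions into that union carries the label equation over.\<close>

lemma contiguous_comp_left: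
  assumes X: "monomial_complex G X" and Y: "monomial_complex G Y" and Z: "monomial_complex G Z"
    and p: "p \<in> simp_hom G X Y" and p': "p' \<in> simp_hom G X Y" and q: "q \<in> simp_hom G Y Z"
    and c: "contiguous G X Y p p'"
  shows "contiguous G X Z (simp_comp G X q p) (simp_comp G X q p')"
proof -
  obtain f u f' u' g v where pq: "p = (f, u)" "p' = (f', u')" "q = (g, v)"
    by (cases p, cases p', cases q)
  note f = simp_homD[OF p[unfolded pq]] and f' = simp_homD[OF p'[unfolded pq]]
    and g = simp_homD[OF q[unfolded pq]]
  note img = image_restrict_comp_simplex[OF X] image_Un[symmetric]
  \<comment> \<open>The right factor \<open>a\<close> is arbitrary, so that one fact serves both
    \<open>u\<close> and \<open>u'\<close>.\<close>
  have push: "slabel Z (g ` \<rho>, g ` \<tau>) \<otimes> (v \<rho> \<otimes> a) = v \<tau> \<otimes> (slabel Y (\<rho>, \<tau>) \<otimes> a)"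
    if "\<rho> \<in> Simps Y" "\<tau> \<in> Simps Y" "\<rho> \<subseteq> \<tau>" "a \<in> carrier G" for \<rho> \<tau> a
  proof -
    have "slabel Z (g ` \<rho>, g ` \<tau>) \<otimes> (v \<rho> \<otimes> a) = (slabel Z (g ` \<rho>, g ` \<tau>) \<otimes> v \<rho>) \<otimes> a"
      by (intro m_assoc[symmetric] slabel_closed[OF Z] g that image_mono)
    then show ?thesis
      using that g slabel_closed[OF Y] by (simp add: m_assoc)
  qed
  show ?thesis
    using c f f' g by (auto simp: pq simp_comp_simp contiguous_def img push cong del: image_cong_simp)
qed

lemma contiguous_comp_right:
  assumes X: "monomial_complex G X" and Z: "monomial_complex G Z"
    and p: "p \<in> simp_hom G X Y" and q: "q \<in> simp_hom G Y Z" and q': "q' \<in> simp_hom G Y Z"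
    and c: "contiguous G Y Z q q'"
  shows "contiguous G X Z (simp_comp G X q p) (simp_comp G X q' p)"
proof -
  obtain f u g v g' v' where pq: "p = (f, u)" "q = (g, v)" "q' = (g', v')"
    by (cases p, cases q, cases q')
  note f = simp_homD[OF p[unfolded pq]] and g = simp_homD[OF q[unfolded pq]]
    and g' = simp_homD[OF q'[unfolded pq]]
  note img = image_restrict_comp_simplex[OF X]
  have "g ` f ` \<sigma> \<union> g' ` f ` \<sigma> \<in> Simps Z \<and>
      slabel Z (g ` f ` \<sigma>, g ` f ` \<sigma> \<union> g' ` f ` \<sigma>) \<otimes> (v (f ` \<sigma>) \<otimes> u \<sigma>) =
      slabel Z (g' ` f ` \<sigma>, g ` f ` \<sigma> \<union> g' ` f ` \<sigma>) \<otimes> (v' (f ` \<sigma>) \<otimes> u \<sigma>)"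
    if s: "\<sigma> \<in> Simps X" for \<sigma>
    using c f(4)[OF s] f(5)[OF s] g g' slabel_closed[OF Z]
    by (simp add: pq contiguous_def flip: m_assoc)
  then show ?thesis
    by (auto simp: pq simp_comp_simp contiguous_def img cong del: image_cong_simp)
qed

lemma hom_congruence_simp_homotopy: "hom_congruence (Simp_cat G) (simp_homotopy G)"
  unfolding simp_homotopy_eq_trancl[abs_def]
proof (rule hom_congruence_trancl[OF is_category_Simp_cat], goal_cases)
  case 2
  then show ?case
    by (auto simp: Simp_cat_def refl_on_def contiguity_def intro: contiguous_refl)
next
  case 3
  then show ?case
    by (auto simp: sym_def contiguity_def intro: contiguous_sym)
next
  case 4
  then show ?case
    by (auto simp: Simp_cat_def contiguity_def intro: simp_comp_closed contiguous_comp_left)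
next
  case 5
  then show ?case
    by (auto simp: Simp_cat_def contiguity_def intro: simp_comp_closed contiguous_comp_right)
qed (auto simp: Simp_cat_def contiguity_def)

end

section \<open>The poset of simplices\<close>

lemma Pi_obj_simps [simp]:
  "Elts (Pi_obj X) = Simps X" "Leq (Pi_obj X) = inclusion_on (Simps X)" "plabel (Pi_obj X) = slabel X"
  by (simp_all add: Pi_obj_def)

lemma in_inclusion_on_iff: "(\<sigma>, \<tau>) \<in> inclusion_on K \<longleftrightarrow> \<sigma> \<in> K \<and> \<tau> \<in> K \<and> \<sigma> \<subseteq> \<tau>"
  by (simp add: inclusion_on_def)

lemma monomial_poset_Pi_obj:
  assumes "monomial_complex A X"
  shows "monomial_poset A (Pi_obj X)"
proof -
  have "partial_order_on (Simps X) (inclusion_on (Simps X))"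
    by (auto simp: partial_order_on_def preorder_on_def refl_on_def trans_def antisym_def inclusion_on_def)
  with assms show ?thesis
    by (auto simp: monomial_poset_def monomial_complex_def in_inclusion_on_iff)
qed

lemma Pi_mor_closed: "p \<in> simp_hom A X Y \<Longrightarrow> Pi_mor X p \<in> poset_hom A (Pi_obj X) (Pi_obj Y)"
  by (cases p) (auto simp: Pi_mor_def in_inclusion_on_iff simp_homD image_mono simp del: image_subset_iff
      intro!: poset_homI)

lemma finite_poset_Pi_obj:
  assumes "monomial_complex A X" "finite_complex X"
  shows "finite_poset (Pi_obj X)"
proof -
  have "Simps X \<subseteq> Pow (Verts X)"
    using monomial_complex_SimpsD[OF assms(1)] by blast
  then show ?thesis
    using assms(2) by (simp add: finite_subset)
qed

context monoid
begin

lemma Pi_mor_contiguity: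
  assumes X: "monomial_complex G X" and Y: "monomial_complex G Y"
    and pq: "(p, q) \<in> contiguity G X Y"
  shows "(Pi_mor X p, Pi_mor X q) \<in> poset_homotopy G (Pi_obj X) (Pi_obj Y)"
proof -
  obtain f u f' u' where eq: "p = (f, u)" "q = (f', u')"
    by (cases p, cases q)
  have p: "(f, u) \<in> simp_hom G X Y" and q: "(f', u') \<in> simp_hom G X Y"
    and c: "contiguous G X Y (f, u) (f', u')"
    using pq by (auto simp: contiguity_def eq)
  note f = simp_homD[OF p] and f' = simp_homD[OF q]
  define h where "h = (\<lambda>\<sigma>\<in>Simps X. f ` \<sigma> \<union> f' ` \<sigma>)"
  define w where "w = (\<lambda>\<sigma>\<in>Simps X. slabel Y (f ` \<sigma>, h \<sigma>) \<otimes> u \<sigma>)"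
  have ext: "h \<in> extensional (Simps X)" "w \<in> extensional (Simps X)"
    by (simp_all add: h_def w_def)
  have h: "h \<sigma> \<in> Simps Y" "f ` \<sigma> \<subseteq> h \<sigma>" "f' ` \<sigma> \<subseteq> h \<sigma>" if "\<sigma> \<in> Simps X" for \<sigma>
    using c that by (auto simp: contiguous_def h_def)
  have h_mono: "h \<sigma> \<subseteq> h \<tau>" if "\<sigma> \<in> Simps X" "\<tau> \<in> Simps X" "\<sigma> \<subseteq> \<tau>" for \<sigma> \<tau>
    using that by (auto simp: h_def)
  \<comment> \<open>The second form is the label equation of contiguity. It restores the symmetry
    between the two morphisms that the definition of \<open>w\<close> through \<open>f\<close>
    hides.\<close>
  have w: "w \<sigma> = slabel Y (f ` \<sigma>, h \<sigma>) \<otimes> u \<sigma>" "w \<sigma> = slabel Y (f' ` \<sigma>, h \<sigma>) \<otimes> u' \<sigma>"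
    if "\<sigma> \<in> Simps X" for \<sigma>
    using c that by (auto simp: contiguous_def h_def w_def)
  have "(h, w) \<in> poset_hom G (Pi_obj X) (Pi_obj Y)"
  proof (rule poset_homI)
    fix \<sigma> \<tau> assume "(\<sigma>, \<tau>) \<in> Leq (Pi_obj X)"
    then have st: "\<sigma> \<in> Simps X" "\<tau> \<in> Simps X" "\<sigma> \<subseteq> \<tau>"
      by (auto simp: in_inclusion_on_iff)
    then show "(h \<sigma>, h \<tau>) \<in> Leq (Pi_obj Y)"
      by (simp add: in_inclusion_on_iff h h_mono)
    have fs: "f ` \<sigma> \<in> Simps Y" "f ` \<tau> \<in> Simps Y" "f ` \<sigma> \<subseteq> f ` \<tau>"
      using f st by auto
    \<comment> \<open>The label from \<open>f\<close> \<sigma>\<open>to\<close>h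
      \<tau>\<open>is computed along two routes, through\<close>h
      \<sigma>\<open>and through\<close>f \<open>\<tau>\<close>; on the second route the square of
      \<open>(f, u)\<close> applies.\<close>
    have "slabel Y (h \<sigma>, h \<tau>) \<otimes> w \<sigma> = (slabel Y (h \<sigma>, h \<tau>) \<otimes> slabel Y (f ` \<sigma>, h \<sigma>)) \<otimes> u \<sigma>"
      using st fs f h h_mono slabel_closed[OF Y] by (simp add: w(1) m_assoc)
    also have "\<dots> = slabel Y (f ` \<sigma>, h \<tau>) \<otimes> u \<sigma>"
      using slabel_trans[OF Y fs(1) h(1)[OF st(1)] h(1)[OF st(2)] h(2)[OF st(1)] h_mono[OF st]] by simp
    also have "\<dots> = (slabel Y (f ` \<tau>, h \<tau>) \<otimes> slabel Y (f ` \<sigma>, f ` \<tau>)) \<otimes> u \<sigma>"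
      using slabel_trans[OF Y fs(1,2) h(1)[OF st(2)] fs(3) h(2)[OF st(2)]] by simp
    also have "\<dots> = slabel Y (f ` \<tau>, h \<tau>) \<otimes> (u \<tau> \<otimes> slabel X (\<sigma>, \<tau>))"
      using st fs f h slabel_closed[OF Y] by (simp add: m_assoc f(6)[OF st])
    also have "\<dots> = w \<tau> \<otimes> slabel X (\<sigma>, \<tau>)"
      using st fs f h slabel_closed[OF Y] slabel_closed[OF X] by (simp add: w(1) m_assoc)
    finally show "plabel (Pi_obj Y) (h \<sigma>, h \<tau>) \<otimes> w \<sigma> = w \<tau> \<otimes> plabel (Pi_obj X) (\<sigma>, \<tau>)"
      by simp
  next
    fix \<sigma> assume "\<sigma> \<in> Elts (Pi_obj X)"
    then show "w \<sigma> \<in> carrier G"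
      using f h slabel_closed[OF Y] by (simp add: w(1))
  qed (use ext h in simp_all)
  moreover have "poset_hom_le G (Pi_obj X) (Pi_obj Y) (Pi_mor X p) (h, w)"
    using f h by (simp add: eq poset_hom_le_def Pi_mor_def in_inclusion_on_iff w(1))
  moreover have "poset_hom_le G (Pi_obj X) (Pi_obj Y) (Pi_mor X q) (h, w)"
    using f' h by (simp add: eq poset_hom_le_def Pi_mor_def in_inclusion_on_iff w(2))
  \<comment> \<open>The zigzag goes up from \<open>Pi_mor X p\<close> to \<open>(h, w)\<close> and
    down again to \<open>Pi_mor X q\<close>.\<close>
  ultimately have "(Pi_mor X p, (h, w)) \<in> poset_comparable G (Pi_obj X) (Pi_obj Y)"
    and "((h, w), Pi_mor X q) \<in> poset_comparable G (Pi_obj X) (Pi_obj Y)"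
    using Pi_mor_closed[OF p] Pi_mor_closed[OF q] by (simp_all add: poset_comparable_def eq)
  then show ?thesis
    unfolding poset_homotopy_eq_trancl by (meson r_into_trancl trancl_into_trancl)
qed

lemma Pi_mor_simp_homotopy:
  assumes "monomial_complex G X" "monomial_complex G Y" "(p, q) \<in> simp_homotopy G X Y"
  shows "(Pi_mor X p, Pi_mor X q) \<in> poset_homotopy G (Pi_obj X) (Pi_obj Y)"
  using assms(3) Pi_mor_contiguity[OF assms(1,2)]
  unfolding simp_homotopy_eq_trancl poset_homotopy_eq_trancl by (rule trancl_image[where h = "Pi_mor X"])

lemma Pi_mor_simp_comp:
  assumes X: "monomial_complex G X" and p: "p \<in> simp_hom G X Y"
  shows "Pi_mor X (simp_comp G X q p) = poset_comp G (Pi_obj X) (Pi_mor Y q) (Pi_mor X p)"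
proof -
  obtain f u g v where pq: "p = (f, u)" "q = (g, v)"
    by (cases p, cases q)
  show ?thesis
    using simp_homD[OF p[unfolded pq]]
    by (simp add: pq Pi_mor_def simp_comp_simp poset_comp_simp image_restrict_comp_simplex[OF X]
        cong: restrict_cong cong del: image_cong_simp)
qed

lemma is_functor_Pi_functor:
  "is_functor (Simp_cat G :: (('x, 'a) msimp, ('x, 'x, 'a) simp_mor) cat) (Poset_cat G) Pi_functor"
proof -
  have "Pi_mor X (\<lambda>x\<in>Verts X. x, \<lambda>\<sigma>\<in>Simps X. \<one>) = (\<lambda>\<sigma>\<in>Simps X. \<sigma>, \<lambda>\<sigma>\<in>Simps X. \<one>)"
    if "monomial_complex G X" for X :: "('x, 'a) msimp"
    by (simp add: Pi_mor_def image_restrict_simplex[OF that] cong: restrict_cong cong del: image_cong_simp)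
  then show ?thesis
    unfolding is_functor_def
    by (intro conjI is_category_Simp_cat is_category_Poset_cat)
      (simp_all add: Simp_cat_def Poset_cat_def Pi_functor_def monomial_poset_Pi_obj Pi_mor_closed
        Pi_mor_simp_comp)
qed

lemma congruence_functor_Pi_functor:
  "congruence_functor (Simp_cat G) (Poset_cat G) (simp_homotopy G) (poset_homotopy G) Pi_functor"
  by (intro congruence_functor.intro is_functor_Pi_functor hom_congruence_simp_homotopy
      hom_congruence_poset_homotopy)
    (simp add: Simp_cat_def Pi_functor_def Pi_mor_simp_homotopy)

end

theorem lemma5p5:
  fixes A :: "('a, 'b) monoid_scheme"
  assumes "group A"
  shows
    "(\<forall>(X :: ('s, 'a) msimp) (Y :: ('t, 'a) msimp) p q.
        monomial_complex A X \<and> monomial_complex A Y \<and>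
        p \<in> simp_hom A X Y \<and> q \<in> simp_hom A X Y \<and> (p, q) \<in> simp_homotopy A X Y \<longrightarrow>
        (Pi_mor X p, Pi_mor X q) \<in> poset_homotopy A (Pi_obj X) (Pi_obj Y)) \<and>
     (\<exists>Pi_bar :: (('u, 'a) msimp, ('u, 'u, 'a) simp_mor set,
                  ('u set, 'a) mposet, ('u set, 'u set, 'a) poset_mor set) cat_functor.
        is_functor (H_Simp A) (H_Poset A) Pi_bar \<and>
        is_functor (H_simp A) (H_poset A) Pi_bar \<and>
        equal_functors (Simp_cat A) (H_Poset A)
          (functor_comp Pi_bar (Q_Simp A)) (functor_comp (Q_Poset A) Pi_functor) \<and>
        equal_functors (simp_cat A) (H_poset A)
          (functor_comp Pi_bar (Q_Simp A)) (functor_comp (Q_Poset A) Pi_functor))"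
proof -
  interpret group A by fact
  \<comment> \<open>A category has one vertex type \<open>'u\<close> for all its objects. The first
    conjunct, with types \<open>'s\<close> and \<open>'t\<close>, is instead taken directly from
    \<open>Pi_mor_simp_homotopy\<close>.\<close>
  interpret Pi: congruence_functor "Simp_cat A :: (('u, 'a) msimp, _) cat" "Poset_cat A"
    "simp_homotopy A" "poset_homotopy A" Pi_functor
    by (rule congruence_functor_Pi_functor)
  let ?Pi_bar = "induced_functor (poset_homotopy A) Pi_functor ::
    (('u, 'a) msimp, ('u, 'u, 'a) simp_mor set, ('u set, 'a) mposet, ('u set, 'u set, 'a) poset_mor set) cat_functor"
  have fin: "finite_poset (fobj Pi_functor X)"
    if "X \<in> Obj (Simp_cat A)" "finite_complex X" for X :: "('u, 'a) msimp"
    using that finite_poset_Pi_obj by (auto simp: Simp_cat_def Pi_functor_def)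
  have functor_H: "is_functor (H_Simp A) (H_Poset A) ?Pi_bar"
    unfolding H_Simp_def H_Poset_def by (rule Pi.is_functor_induced_functor)
  have equal_H: "equal_functors (Simp_cat A) (H_Poset A)
      (functor_comp ?Pi_bar (Q_Simp A)) (functor_comp (Q_Poset A) Pi_functor)"
    unfolding H_Poset_def Q_Simp_def Q_Poset_def by (rule Pi.induced_functor_quotient_functor)
  \<comment> \<open>\<open>H_simp\<close> and \<open>H_poset\<close> are full subcategories of the
    large quotients, so the same \<open>?Pi_bar\<close> serves and only finiteness of the poset of
    simplices enters.\<close>
  have "is_functor (H_simp A) (H_poset A) ?Pi_bar"
    unfolding H_simp_def H_poset_def
    by (rule is_functor_full_subcat[OF functor_H]) (use fin in \<open>simp add: H_Simp_def\<close>)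
  moreover have "equal_functors (simp_cat A) (H_poset A)
      (functor_comp ?Pi_bar (Q_Simp A)) (functor_comp (Q_Poset A) Pi_functor)"
    unfolding simp_cat_def H_poset_def
    \<comment> \<open>The quotient functor is the identity on objects, so the condition on objects
      is again \<open>fin\<close>.\<close>
    by (rule equal_functors_full_subcat[OF equal_H])
      (use fin in \<open>simp add: functor_comp_def Q_Simp_def quotient_functor_def\<close>)
  ultimately show ?thesis
    using Pi_mor_simp_homotopy functor_H equal_H by blast
qed

end
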